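(* Let $\mathcal{A}_1,\dots,\mathcal{A}_d\in\mathbb{R}^{n_1\times n_2\times n_3}$ be linearly independent (in particular all nonzero), let $\mathscr{A}(\mathcal{T})=(\langle\mathcal{A}_1,\mathcal{T}\rangle,\dots,\langle\mathcal{A}_d,\mathcal{T}\rangle)\in\mathbb{R}^d$, let $\mathbf{b}\in\mathbb{R}^d$, and suppose that the problem TNN-Min, $\min\{\|\mathcal{T}\|_*:\mathscr{A}(\mathcal{T})=\mathbf{b}\}$, is feasible. Run the adaptive algorithm defined in the context, let $(\boldsymbol\lambda_t^*,\mathcal{Z}_t^* )$ be the optimal solution of DUAL(D) obtained at iteration $t$, and let $\Psi^*$ be the set of optimal solutions of DUAL. If the algorithm terminates at some finite iteration $t^*$, then $(\boldsymbol\lambda_{t^*}^*,\mathcal{Z}_{t^*}^* )$ is an optimal solution of DUAL and the output $\widehat{\mathcal{T}}$ is an optimal solution of TNN-Min. If the algorithm does not terminate in finitely many iterations, then: (i) any limit point of $\{(\boldsymbol\lambda_t^*,\mathcal{Z}_t^* )\}_{t=0}^\infty$ belongs to $\Psi^*$; (ii) $\lim_{t\to\infty}(\boldsymbol\lambda_t^* )^\top\mathbf{b}=\mathrm{val}(\text{DUAL})$; (iii) if $\mathcal{T}_t^*$ denotes (the $\mathcal{T}$-component of) an optimal solution of PRIMAL(D) with $\Upsilon=\Upsilon_t$, then $\lim_{t\to\infty}\|\mathcal{T}_t^*\|_*=\mathrm{val}(\text{TNN-Min})$.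
   Context: $\mathbb{B}^{n}=\{\mathbf{x}\in\mathbb{R}^n:\|\mathbf{x}\|=1\}$; $\langle\cdot,\cdot\rangle$ is the entrywise (Frobenius) inner product; $(\mathbf{x}\otimes\Gamma)(j_1,j_2,j_3)=x_{j_1}\Gamma(j_2,j_3)$. For $\mathcal{Z}\in\mathbb{R}^{n_1\times n_2\times n_3}$ with first-mode slices $\mathbf{Z}_j\in\mathbb{R}^{n_2\times n_3}$, $\mathcal{Z}(\mathbf{x})=\sum_{j=1}^{n_1}x_j\mathbf{Z}_j$. For a matrix, $\|\cdot\|_\sigma$ is the spectral norm (largest singular value). $\mathrm{val}(\cdot)$ is the optimal value. The tensor nuclear norm is $$\|\mathcal{T}\|_*=\min\left\{\sum_{r=1}^R|\lambda_r|:\ \mathcal{T}=\sum_{r=1}^R\lambda_r\,\mathbf{x}_1^{(r)}\otimes\mathbf{x}_2^{(r)}\otimes\mathbf{x}_3^{(r)},\ R\in\mathbb{N},\ \lambda_r\in\mathbb{R},\ \mathbf{x}_\ell^{(r)}\in\mathbb{R}^{n_\ell},\ \|\mathbf{x}_\ell^{(r)}\|=1\ \forall \ell,r\right\}.$$ DUAL: maximize $\boldsymbol\lambda^\top\mathbf{b}$ over $\boldsymbol\lambda\in\mathbb{R}^d$, $\mathcal{Z}\in\mathbb{R}^{n_1\times n_2\times n_3}$ subject to $$\begin{bmatrix}\mathbf{I}_{n_2}&\mathcal{Z}(\mathbf{x})\\ \mathcal{Z}(\mathbf{x})^\top&\mathbf{I}_{n_3}\end{bmatrix}\succeq0\ \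 \forall\mathbf{x}\in\mathbb{B}^{n_1},\qquad \mathcal{Z}=\sum_{\ell=1}^d\lambda_\ell\mathcal{A}_\ell.$$ DUAL(D), for a finite set $\Upsilon\subseteq\mathbb{B}^{n_1}$: the same as DUAL except that the semidefinite constraint is imposed only for $\mathbf{x}\in\Upsilon$. PRIMAL(D), for a finite set $\Upsilon=\{\mathbf{x}_1,\dots,\mathbf{x}_m\}\subseteq\mathbb{B}^{n_1}$: minimize $\frac12\sum_{i=1}^m\operatorname{tr}(\Lambda_i)$ over $\mathcal{T}\in\mathbb{R}^{n_1\times n_2\times n_3}$ and symmetric $\Lambda_1,\dots,\Lambda_m$ subject to $\Lambda_i=\begin{bmatrix}\Lambda_i^{(1)}&\Gamma_i\\ \Gamma_i^\top&\Lambda_i^{(2)}\end{bmatrix}\succeq0$ (blocks $\Lambda_i^{(1)}\in\mathbb{R}^{n_2\times n_2}$, $\Gamma_i\in\mathbb{R}^{n_2\times n_3}$, $\Lambda_i^{(2)}\in\mathbb{R}^{n_3\times n_3}$) for all $i$, $\mathcal{T}=\sum_{i=1}^m\mathbf{x}_i\otimes\Gamma_i$, and $\mathscr{A}(\mathcal{T})=\mathbf{b}$. Adaptive algorithm: Choose $\Upsilon_0=\{\mathbf{x}_1,\dots,\mathbf{x}_{n_1}\}\subseteq\mathbb{B}^{n_1}$ spanning $\mathbb{R}^{n_1}$. For $t=0,1,2,\dots$: (1) solve DUAL(D) with $\Upsilon=\Upsilon_t$, obtaining an (arbitrary) optimal solution $(\boldsymbol\lambda_t^*,\mathcal{Z}_t^*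 )$; (2) choose $\mathbf{x}_t^*\in\arg\max_{\|\mathbf{x}\|=1}\|\mathcal{Z}_t^*(\mathbf{x})\|_\sigma$; (3) if $\mathbf{x}_t^*\in\Upsilon_t$, set $\Upsilon_*=\Upsilon_t$ and exit the loop (the algorithm terminates at iteration $t$); otherwise set $\Upsilon_{t+1}=\Upsilon_t\cup\{\mathbf{x}_t^*\}$ and continue. After exiting the loop, solve PRIMAL(D) with $\Upsilon=\Upsilon_*$ and output the $\mathcal{T}$-component $\widehat{\mathcal{T}}$ of an optimal solution. *)

theory Defs
  imports "HOL-Analysis.Analysis"
begin

section \<open>Tensors of order three\<close>

text \<open>
  An \<open>n1 \<times> n2 \<times> n3\<close> tensor \<open>T\<close> has type \<open>real^'n3^'n2^'n1\<close>: the entry at \<open>(j1, j2, j3)\<close> is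
  \<open>T $ j1 $ j2 $ j3\<close>, the first-mode slice \<open>T $ j1\<close> is an \<open>n2 \<times> n3\<close> matrix, and the inner
  product \<open>S \<bullet> T\<close> of the type is the entrywise (Frobenius) one.
\<close>

definition outer3 :: "real^'n1 \<Rightarrow> real^'n2 \<Rightarrow> real^'n3 \<Rightarrow> real^'n3^'n2^'n1" where
  "outer3 x y z = (\<chi> j1 j2 j3. x $ j1 * y $ j2 * z $ j3)"

definition outer_mat :: "real^'n1 \<Rightarrow> real^'n3^'n2 \<Rightarrow> real^'n3^'n2^'n1" where
  "outer_mat x G = (\<chi> j1 j2 j3. x $ j1 * G $ j2 $ j3)"

definition contract :: "real^'n3^'n2^'n1 \<Rightarrow> real^'n1 \<Rightarrow> real^'n3^'n2" where
  "contract Z x = (\<Sum>j\<in>UNIV. x $ j *\<^sub>R Z $ j)"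

text \<open>The set of costs is nonempty and bounded below, and its infimum is attained.\<close>

definition tensor_nuclear_norm :: "real^'n3^'n2^'n1 \<Rightarrow> real" where
  "tensor_nuclear_norm T = Inf {(\<Sum>r<R. \<bar>c r\<bar>) | R c x y z.
     (\<forall>r<R. norm (x r) = 1 \<and> norm (y r) = 1 \<and> norm (z r) = 1) \<and>
     T = (\<Sum>r<(R::nat). c r *\<^sub>R outer3 (x r) (y r) (z r))}"


section \<open>Matrices\<close>

definition singular_value :: "real^'n^'m \<Rightarrow> real \<Rightarrow> bool" where
  "singular_value M s \<longleftrightarrow>
     0 \<le> s \<and> (\<exists>v. v \<noteq> 0 \<and> (transpose M ** M) *v v = s\<^sup>2 *\<^sub>R v)"

definition spectral_norm :: "real^'n^'m \<Rightarrow> real" where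
  "spectral_norm M = (GREATEST s. singular_value M s)"

definition psd :: "real^'n^'n \<Rightarrow> bool" where
  "psd M \<longleftrightarrow> transpose M = M \<and> (\<forall>v. 0 \<le> v \<bullet> (M *v v))"

definition block_mat ::
  "real^'m^'m \<Rightarrow> real^'n^'m \<Rightarrow> real^'m^'n \<Rightarrow> real^'n^'n \<Rightarrow> real^('m + 'n)^('m + 'n)" where
  "block_mat P Q R S = (\<chi> i j.
     case i of
       Inl k \<Rightarrow> (case j of Inl l \<Rightarrow> P $ k $ l | Inr l \<Rightarrow> Q $ k $ l)
     | Inr k \<Rightarrow> (case j of Inl l \<Rightarrow> R $ k $ l | Inr l \<Rightarrow> S $ k $ l))"


section \<open>The optimization problems\<close>

text \<open>
  The family \<open>A\<close> and the vector \<open>b\<close> are indexed by a finite type \<open>'d\<close>. A pair \<open>(lam, Z)\<close> is a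
  point of the dual problems.
\<close>

definition measure_map :: "('d \<Rightarrow> real^'n3^'n2^'n1) \<Rightarrow> real^'n3^'n2^'n1 \<Rightarrow> real^'d" where
  "measure_map A T = (\<chi> l. A l \<bullet> T)"

definition tnn_feasible :: "('d \<Rightarrow> real^'n3^'n2^'n1) \<Rightarrow> real^'d \<Rightarrow> real^'n3^'n2^'n1 \<Rightarrow> bool" where
  "tnn_feasible A b T \<longleftrightarrow> measure_map A T = b"

definition tnn_optimal :: "('d \<Rightarrow> real^'n3^'n2^'n1) \<Rightarrow> real^'d \<Rightarrow> real^'n3^'n2^'n1 \<Rightarrow> bool" where
  "tnn_optimal A b = is_arg_min tensor_nuclear_norm (tnn_feasible A b)"

definition tnn_val :: "('d \<Rightarrow> real^'n3^'n2^'n1) \<Rightarrow> real^'d \<Rightarrow> real" where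
  "tnn_val A b = Inf (tensor_nuclear_norm ` {T. tnn_feasible A b T})"

text \<open>
  The semidefinite constraint is imposed for \<open>x \<in> X\<close>: a finite \<open>X\<close> gives the discretized dual
  problem, and \<open>X = sphere 0 1\<close> gives the full one.
\<close>

definition dual_feasible ::
  "('d::finite \<Rightarrow> real^'n3^'n2^'n1) \<Rightarrow> (real^'n1) set \<Rightarrow>
   (real^'d) \<times> (real^'n3^'n2^'n1) \<Rightarrow> bool" where
  "dual_feasible A X = (\<lambda>(lam, Z).
     (\<forall>x\<in>X. psd (block_mat (mat 1) (contract Z x) (transpose (contract Z x)) (mat 1))) \<and>
     Z = (\<Sum>l\<in>UNIV. lam $ l *\<^sub>R A l))"

definition dual_optimal ::
  "('d::finite \<Rightarrow> real^'n3^'n2^'n1) \<Rightarrow> real^'d \<Rightarrow> (real^'n1) set \<Rightarrow>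
   (real^'d) \<times> (real^'n3^'n2^'n1) \<Rightarrow> bool" where
  "dual_optimal A b X = is_arg_max (\<lambda>(lam, Z). lam \<bullet> b) (dual_feasible A X)"

definition dual_val ::
  "('d::finite \<Rightarrow> real^'n3^'n2^'n1) \<Rightarrow> real^'d \<Rightarrow> (real^'n1) set \<Rightarrow> real" where
  "dual_val A b X = Sup ((\<lambda>(lam, Z). lam \<bullet> b) ` {p. dual_feasible A X p})"

text \<open>
  The matrices of the discretized primal problem are indexed by the points of the finite set \<open>X\<close>
  themselves. Since \<open>psd\<close> includes symmetry, \<open>Lam x\<close> has the form
  \<open>block_mat P (corner (Lam x)) (transpose (corner (Lam x))) S\<close>.
\<close>

definition corner :: "real^('m + 'n)^('m + 'n) \<Rightarrow> real^'n^'m" where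
  "corner L = (\<chi> i j. L $ Inl i $ Inr j)"

definition primal_feasible ::
  "('d \<Rightarrow> real^'n3^'n2^'n1) \<Rightarrow> real^'d \<Rightarrow> (real^'n1) set \<Rightarrow>
   (real^'n3^'n2^'n1) \<times> (real^'n1 \<Rightarrow> real^('n2 + 'n3)^('n2 + 'n3)) \<Rightarrow> bool" where
  "primal_feasible A b X = (\<lambda>(T, Lam).
     (\<forall>x\<in>X. psd (Lam x)) \<and>
     T = (\<Sum>x\<in>X. outer_mat x (corner (Lam x))) \<and>
     measure_map A T = b)"

definition primal_optimal ::
  "('d \<Rightarrow> real^'n3^'n2^'n1) \<Rightarrow> real^'d \<Rightarrow> (real^'n1) set \<Rightarrow>
   (real^'n3^'n2^'n1) \<times> (real^'n1 \<Rightarrow> real^('n2 + 'n3)^('n2 + 'n3)) \<Rightarrow> bool" where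
  "primal_optimal A b X =
     is_arg_min (\<lambda>(T, Lam). 1/2 * (\<Sum>x\<in>X. trace (Lam x))) (primal_feasible A b X)"


section \<open>The adaptive algorithm\<close>

text \<open>
  A run is described by sequences indexed by the iteration number. They are constrained only at
  the iterations that are actually executed, and are arbitrary afterwards.
\<close>

definition reached :: "(nat \<Rightarrow> (real^'n1) set) \<Rightarrow> (nat \<Rightarrow> real^'n1) \<Rightarrow> nat \<Rightarrow> bool" where
  "reached Ups xs t \<longleftrightarrow> (\<forall>s<t. xs s \<notin> Ups s)"

definition terminates_at :: "(nat \<Rightarrow> (real^'n1) set) \<Rightarrow> (nat \<Rightarrow> real^'n1) \<Rightarrow> nat \<Rightarrow> bool" where
  "terminates_at Ups xs t \<longleftrightarrow> reached Ups xs t \<and> xs t \<in> Ups t"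

definition adaptive_run ::
  "('d::finite \<Rightarrow> real^'n3^'n2^'n1) \<Rightarrow> real^'d \<Rightarrow> (nat \<Rightarrow> (real^'n1) set) \<Rightarrow>
   (nat \<Rightarrow> real^'d) \<Rightarrow> (nat \<Rightarrow> real^'n3^'n2^'n1) \<Rightarrow> (nat \<Rightarrow> real^'n1) \<Rightarrow> bool" where
  "adaptive_run A b Ups lam Z xs \<longleftrightarrow>
     card (Ups 0) = CARD('n1) \<and> Ups 0 \<subseteq> sphere 0 1 \<and> span (Ups 0) = UNIV \<and>
     (\<forall>t. reached Ups xs t \<longrightarrow>
        dual_optimal A b (Ups t) (lam t, Z t) \<and>
        is_arg_max (\<lambda>x. spectral_norm (contract (Z t) x)) (\<lambda>x. norm x = 1) (xs t) \<and>
        (xs t \<notin> Ups t \<longrightarrow> Ups (Suc t) = insert (xs t) (Ups t)))"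

end

theory Submission
  imports Defs
begin

text \<open>
  The semidefinite constraint at \<open>x\<close> says that \<open>contract Z x\<close> has operator norm at most \<open>1\<close>, that
  is, \<open>Z \<bullet> outer3 x u w \<le> 1\<close> for all unit vectors \<open>u\<close>, \<open>w\<close>. Hence \<open>Z \<bullet> T\<close> is at most the nuclear norm
  of \<open>T\<close> for every feasible point of the full dual. Conversely, splitting the matrices \<open>Lam x\<close> into
  rank-one summands bounds the nuclear norm by the cost of the discretized primal problem, and a
  separation argument identifies this cost with the discretized dual value. An optimal \<open>T\<close> of the
  discretized primal problem thus has nuclear norm at most \<open>lam \<bullet> b\<close>, and everything reduces to
  the convergence of the dual values.

  These decrease, and the iterates are bounded because the initial samples span. Along a
  subsequence with limit \<open>Z'\<close> the bound \<open>1\<close> holds for \<open>Z'\<close> at all samples \<open>xs (r k)\<close>, and up to an error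
  tending to \<open>0\<close> the norm of \<open>contract Z' x\<close> is at most that of \<open>contract (Z (r k)) x\<close>, hence that of
  \<open>contract (Z (r k)) (xs (r k))\<close>, hence that of \<open>contract Z' (xs (r k))\<close>. So \<open>Z'\<close> is feasible for the
  full dual problem.
\<close>

section \<open>Positive semidefinite matrices\<close>

text \<open>For nonzero \<open>c\<close> the bound is the value at the minimizer
  \<open>- b / c\<close>; for \<open>c = 0\<close> a nonnegative affine function must be
  constant.\<close>

lemma nonneg_quadratic_discriminant:
  fixes a b c :: real
  assumes "0 \<le> c" and "\<And>t. 0 \<le> a + 2 * t * b + t\<^sup>2 * c"
  shows "b\<^sup>2 \<le> a * c"
proof (cases "c = 0")
  case True
  have "b = 0"
  proof (rule ccontr)
    assume "b \<noteq> 0"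
    then show False
      \<comment> \<open>This choice of \<open>t\<close> gives the affine function the value
        \<open>-1\<close>.\<close>
      using assms(2)[of "- (a + 1) / (2 * b)"] True by (simp add: field_simps)
  qed
  then show ?thesis using True by simp
next
  case False
  then show ?thesis
    using assms(1) assms(2)[of "- b / c"] by (simp add: field_simps power2_eq_square)
qed

lemma psd_inner_commute:
  fixes M :: "real^'n^'n"
  assumes "psd M"
  shows "x \<bullet> (M *v y) = y \<bullet> (M *v x)"
  using assms unfolding psd_def by (metis dot_lmul_matrix inner_commute transpose_matrix_vector)

text \<open>Along the line \<open>x + t *\<^sub>R y\<close> the form of \<open>M\<close> is a
  nonnegative quadratic polynomial in \<open>t\<close>, so the discriminant bound applies.\<close>

lemma psd_Cauchy_Schwarz:
  fixes M :: "real^'n^'n"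
  assumes "psd M"
  shows "(x \<bullet> (M *v y))\<^sup>2 \<le> (x \<bullet> (M *v x)) * (y \<bullet> (M *v y))"
proof (rule nonneg_quadratic_discriminant)
  show "0 \<le> y \<bullet> (M *v y)"
    using assms unfolding psd_def by blast
  fix t :: real
  have "0 \<le> (x + t *\<^sub>R y) \<bullet> (M *v (x + t *\<^sub>R y))"
    using assms unfolding psd_def by blast
  also have "\<dots> = x \<bullet> (M *v x) + 2 * t * (x \<bullet> (M *v y)) + t\<^sup>2 * (y \<bullet> (M *v y))"
    using psd_inner_commute[OF assms, of y x]
    by (simp add: matrix_vector_right_distrib matrix_vector_mult_scaleR inner_add_left
        inner_add_right power2_eq_square algebra_simps)
  finally show "0 \<le> x \<bullet> (M *v x) + 2 * t * (x \<bullet> (M *v y)) + t\<^sup>2 * (y \<bullet> (M *v y))" .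
qed

text \<open>Cauchy--Schwarz for the pair \<open>M *v v\<close>, \<open>v\<close> makes the norm of
  \<open>M *v v\<close> vanish. This later turns a maximizer into an eigenvector.\<close>

lemma psd_quadratic_zero:
  fixes M :: "real^'n^'n"
  assumes "psd M" "v \<bullet> (M *v v) = 0"
  shows "M *v v = 0"
  using psd_Cauchy_Schwarz[OF assms(1), of "M *v v" v] assms(2) by simp

section \<open>Rank-one matrices and the splitting of positive semidefinite matrices\<close>

definition rank1 :: "real^'m \<Rightarrow> real^'n \<Rightarrow> real^'n^'m" where
  "rank1 u v = (\<chi> i j. u $ i * v $ j)"

lemma rank1_mult_vec: "rank1 u v *v x = (v \<bullet> x) *\<^sub>R u"
  by (simp add: vec_eq_iff rank1_def matrix_vector_mult_def inner_vec_def sum_distrib_left mult_ac)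

lemma psd_rank1: "psd (rank1 u u)"
  unfolding psd_def
proof (intro conjI allI)
  show "transpose (rank1 u u) = rank1 u u"
    by (simp add: transpose_def rank1_def vec_eq_iff)
  show "0 \<le> v \<bullet> (rank1 u u *v v)" for v
    by (simp add: rank1_mult_vec inner_commute)
qed

lemma trace_rank1: "trace (rank1 u u) = (norm u)\<^sup>2"
  by (simp add: trace_def rank1_def power2_norm_eq_inner inner_vec_def)

lemma psd_entry_commute: "psd M \<Longrightarrow> M $ i $ j = M $ j $ i"
  unfolding psd_def transpose_def by (metis vec_lambda_beta)

lemma psd_0: "psd 0"
  by (simp add: psd_def transpose_def vec_eq_iff)

lemma psd_add: "psd M \<Longrightarrow> psd N \<Longrightarrow> psd (M + N)"
  by (auto simp: psd_def transpose_def vec_eq_iff matrix_vector_mult_add_rdistrib inner_add_right)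

lemma psd_scaleR: "0 \<le> c \<Longrightarrow> psd M \<Longrightarrow> psd (c *\<^sub>R M)"
  by (auto simp: psd_def transpose_def vec_eq_iff scaleR_matrix_vector_assoc[symmetric])

text \<open>Subtracting \<open>M e\<^sub>i (M e\<^sub>i)\<^sup>T / M\<^sub>i\<^sub>i\<close> keeps \<open>M\<close> positive semidefinite by Cauchy--Schwarz and
  clears row \<open>i\<close>; rows with a zero diagonal entry stay zero.\<close>

lemma psd_sum_rank1:
  fixes M :: "real^'n^'n"
  assumes "psd M"
  shows "\<exists>N w. M = (\<Sum>k<(N::nat). rank1 (w k) (w k))"
  using assms
proof (induction "card {i. M $ i $ i \<noteq> 0}" arbitrary: M rule: less_induct)
  case less
  have entry: "axis i 1 \<bullet> (M *v axis j 1) = M $ i $ j" for i j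
    by (simp add: matrix_vector_mult_basis inner_axis' column_def)
  have CS: "(M $ i $ j)\<^sup>2 \<le> M $ i $ i * M $ j $ j" for i j
    using psd_Cauchy_Schwarz[OF less.prems, of "axis i 1" "axis j 1"] by (simp add: entry)
  have nonneg: "0 \<le> M $ i $ i" for i
    using less.prems entry[of i i] unfolding psd_def by metis
  show ?case
  proof (cases "{i. M $ i $ i \<noteq> 0} = {}")
    case True
    have "M = 0"
      using CS True by (simp add: vec_eq_iff)
    then show ?thesis by (intro exI[of _ 0]) simp
  next
    case False
    then obtain i where i: "M $ i $ i \<noteq> 0" by blast
    then have pos: "M $ i $ i > 0" using nonneg[of i] by linarith
    define u where "u = (1 / sqrt (M $ i $ i)) *\<^sub>R column i M"
    define M' where "M' = M - rank1 u u"
    have uu: "u $ j * u $ k = M $ j $ i * M $ k $ i / M $ i $ i" for j k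
      using pos by (simp add: u_def column_def)
    have diag: "M' $ j $ j = M $ j $ j - (M $ j $ i)\<^sup>2 / M $ i $ i" for j
      using uu[of j j] by (simp add: M'_def rank1_def power2_eq_square)
    have psd': "psd M'"
      unfolding psd_def
    proof (intro conjI allI)
      show "transpose M' = M'"
        using psd_entry_commute[OF less.prems]
        by (simp add: M'_def rank1_def transpose_def vec_eq_iff mult.commute)
      fix v
      have "u \<bullet> v = (v \<bullet> (M *v axis i 1)) / sqrt (M $ i $ i)"
        by (simp add: u_def matrix_vector_mult_basis inner_commute)
      then have "(u \<bullet> v)\<^sup>2 = (v \<bullet> (M *v axis i 1))\<^sup>2 / M $ i $ i"
        using pos by (simp add: power_divide)
      also have "\<dots> \<le> v \<bullet> (M *v v)"
        using psd_Cauchy_Schwarz[OF less.prems, of v "axis i 1"] pos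
        by (simp add: entry divide_le_eq)
      finally show "0 \<le> v \<bullet> (M' *v v)"
        by (simp add: M'_def matrix_vector_mult_diff_rdistrib rank1_mult_vec inner_diff_right
            power2_eq_square inner_commute)
    qed
    \<comment> \<open>A zero diagonal entry \<open>j\<close> forces \<open>M $ j $ i = 0\<close> by
      Cauchy--Schwarz and so stays zero, while the nonzero entry \<open>i\<close> becomes
      zero.\<close>
    have "{j. M' $ j $ j \<noteq> 0} \<subset> {j. M $ j $ j \<noteq> 0}"
    proof
      show "{j. M' $ j $ j \<noteq> 0} \<subseteq> {j. M $ j $ j \<noteq> 0}"
      proof
        fix j assume "j \<in> {j. M' $ j $ j \<noteq> 0}"
        then show "j \<in> {j. M $ j $ j \<noteq> 0}"
          using CS[of j i] by (auto simp: diag)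
      qed
      show "{j. M' $ j $ j \<noteq> 0} \<noteq> {j. M $ j $ j \<noteq> 0}"
        using i diag[of i] by (auto simp: power2_eq_square)
    qed
    then have "card {j. M' $ j $ j \<noteq> 0} < card {j. M $ j $ j \<noteq> 0}"
      by (intro psubset_card_mono) auto
    from less.hyps[OF this psd'] obtain N w
      where "M' = (\<Sum>k<(N::nat). rank1 (w k) (w k))" by blast
    then have "M = (\<Sum>k<Suc N. rank1 ((w(N := u)) k) ((w(N := u)) k))"
      by (simp add: M'_def algebra_simps)
    then show ?thesis by blast
  qed
qed

section \<open>The spectral norm\<close>

text \<open>Cauchy--Schwarz gives one direction; the other tests with the normalized
  \<open>w\<close> and \<open>M *v w\<close>. The bilinear form on the right is the one that pairs
  with rank-one tensors.\<close>

lemma onorm_matrix_le_iff: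
  fixes M :: "real^'n^'m"
  assumes "0 \<le> c"
  shows "onorm ((*v) M) \<le> c \<longleftrightarrow> (\<forall>u w. norm u = 1 \<longrightarrow> norm w = 1 \<longrightarrow> u \<bullet> (M *v w) \<le> c)"
proof (intro iffI allI impI)
  fix u w assume *: "onorm ((*v) M) \<le> c" "norm (u::real^'m) = 1" "norm (w::real^'n) = 1"
  have "u \<bullet> (M *v w) \<le> norm (M *v w)"
    using norm_cauchy_schwarz[of u "M *v w"] * by simp
  also have "\<dots> \<le> onorm ((*v) M)"
    using onorm[OF matrix_vector_mul_bounded_linear, of M w] * by simp
  finally show "u \<bullet> (M *v w) \<le> c" using * by simp
next
  assume *: "\<forall>u w. norm u = 1 \<longrightarrow> norm w = 1 \<longrightarrow> u \<bullet> (M *v w) \<le> c"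
  show "onorm ((*v) M) \<le> c"
  proof (rule onorm_le)
    fix w
    show "norm (M *v w) \<le> c * norm w"
    proof (cases "w = 0 \<or> M *v w = 0")
      case True
      then show ?thesis using assms by auto
    next
      case False
      have "sgn (M *v w) \<bullet> (M *v sgn w) \<le> c"
        using * False by (simp add: norm_sgn)
      then have "norm (M *v w) / norm w \<le> c"
        using False by (simp add: sgn_div_norm matrix_vector_mult_scaleR power2_norm_eq_inner[symmetric]
            power2_eq_square divide_inverse mult_ac)
      then show ?thesis using False by (simp add: divide_le_eq)
    qed
  qed
qed

text \<open>The operator norm is attained at a unit vector, which is then an eigenvector of
  \<open>transpose M ** M\<close>. Conversely, a singular value is the factor by which some nonzero
  vector is stretched, hence at most the operator norm.\<close>

lemma spectral_norm_eq_onorm: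
  fixes M :: "real^'n^'m"
  shows "spectral_norm M = onorm ((*v) M)"
  unfolding spectral_norm_def
proof (rule Greatest_equality)
  let ?s = "onorm ((*v) M)"
  have bl: "bounded_linear ((*v) M)" by (rule matrix_vector_mul_bounded_linear)
  have quad: "x \<bullet> ((transpose M ** M) *v x) = (norm (M *v x))\<^sup>2" for x
    by (simp add: matrix_vector_mul_assoc[symmetric] power2_norm_eq_inner
        dot_lmul_matrix[symmetric] vector_transpose_matrix transpose_matrix_vector inner_commute)
  have "continuous_on (sphere 0 1) (\<lambda>x. norm (M *v x))"
    by (intro continuous_intros linear_continuous_on bl)
  moreover have "sphere (0::real^'n) 1 \<noteq> {}" by simp
  ultimately obtain v where v: "v \<in> sphere 0 1" and max: "\<forall>x\<in>sphere 0 1. norm (M *v x) \<le> norm (M *v v)"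
    using continuous_attains_sup[OF compact_sphere] by blast
  have "?s \<le> norm (M *v v)"
  proof (rule onorm_le)
    fix x
    show "norm (M *v x) \<le> norm (M *v v) * norm x"
    proof (cases "x = 0")
      case False
      then have "norm (M *v sgn x) \<le> norm (M *v v)" using max by (simp add: norm_sgn)
      then have "norm (M *v x) / norm x \<le> norm (M *v v)"
        by (simp add: sgn_div_norm matrix_vector_mult_scaleR divide_inverse mult_ac)
      then show ?thesis using False by (simp add: divide_le_eq)
    qed simp
  qed
  then have s: "norm (M *v v) = ?s" using onorm[OF bl, of v] v by simp
  \<comment> \<open>\<open>?P\<close> is positive semidefinite because \<open>?s\<close> bounds the
    stretching, and its form vanishes at the maximizer \<open>v\<close>; hence
    \<open>?P *v v = 0\<close>, the eigenvector equation.\<close>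
  let ?P = "?s\<^sup>2 *\<^sub>R mat 1 - transpose M ** M"
  have Pv: "?P *v x = ?s\<^sup>2 *\<^sub>R x - (transpose M ** M) *v x" for x
    by (simp add: matrix_vector_mult_diff_rdistrib scaleR_matrix_vector_assoc[symmetric])
  have "psd ?P"
    unfolding psd_def
  proof (intro conjI allI)
    show "transpose ?P = ?P"
      by (simp add: transpose_def mat_def vec_eq_iff matrix_matrix_mult_def mult.commute eq_commute)
    fix x
    have "(norm (M *v x))\<^sup>2 \<le> (?s * norm x)\<^sup>2"
      by (intro power_mono onorm[OF bl]) simp
    then show "0 \<le> x \<bullet> (?P *v x)"
      by (simp add: Pv inner_diff_right quad power_mult_distrib power2_norm_eq_inner)
  qed
  moreover have "v \<bullet> (?P *v v) = 0"
    using v by (simp add: Pv inner_diff_right quad s power2_norm_eq_inner[symmetric])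
  ultimately have "?P *v v = 0" by (rule psd_quadratic_zero)
  then have "(transpose M ** M) *v v = ?s\<^sup>2 *\<^sub>R v" by (simp add: Pv)
  moreover have "v \<noteq> 0" using v by auto
  ultimately show "singular_value M ?s"
    unfolding singular_value_def using onorm_pos_le[OF bl] by blast
  fix t assume "singular_value M t"
  then obtain x where t: "0 \<le> t" and x: "x \<noteq> 0" "(transpose M ** M) *v x = t\<^sup>2 *\<^sub>R x"
    unfolding singular_value_def by blast
  have "(norm (M *v x))\<^sup>2 = (t * norm x)\<^sup>2"
    using quad[of x] x by (simp add: power_mult_distrib power2_norm_eq_inner)
  then have "norm (M *v x) = t * norm x" using t by (simp add: power2_eq_iff_nonneg)
  then have "t * norm x \<le> ?s * norm x" using onorm[OF bl, of x] by simp
  then show "t \<le> ?s" using x by simp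
qed

section \<open>Block vectors, and the semidefinite constraint as a norm bound\<close>

definition join_vec :: "real^'m \<Rightarrow> real^'n \<Rightarrow> real^('m + 'n)" where
  "join_vec u w = (\<chi> i. case i of Inl k \<Rightarrow> u $ k | Inr k \<Rightarrow> w $ k)"

lemma join_vec_split:
  obtains u w where "v = join_vec u w"
proof
  show "v = join_vec (\<chi> k. v $ Inl k) (\<chi> k. v $ Inr k)"
    by (simp add: join_vec_def vec_eq_iff split: sum.split)
qed

lemma sum_UNIV_sum:
  "(\<Sum>i\<in>(UNIV :: ('a::finite + 'b::finite) set). f i) = (\<Sum>i\<in>UNIV. f (Inl i)) + (\<Sum>i\<in>UNIV. f (Inr i))"
  by (simp add: UNIV_Plus_UNIV[symmetric] sum.Plus del: UNIV_Plus_UNIV)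

lemma inner_join_vec: "join_vec u w \<bullet> join_vec u' w' = u \<bullet> u' + w \<bullet> w'"
  by (simp add: inner_vec_def sum_UNIV_sum join_vec_def)

lemma norm_join_vec: "(norm (join_vec u w))\<^sup>2 = (norm u)\<^sup>2 + (norm w)\<^sup>2"
  by (simp add: power2_norm_eq_inner inner_join_vec)

lemma block_mat_mult_join_vec:
  "block_mat P Q R S *v join_vec u w = join_vec (P *v u + Q *v w) (R *v u + S *v w)"
  by (simp add: vec_eq_iff block_mat_def join_vec_def matrix_vector_mult_def sum_UNIV_sum
      split: sum.split)

lemma corner_rank1: "corner (rank1 (join_vec u w) (join_vec u' w')) = rank1 u w'"
  by (simp add: corner_def rank1_def join_vec_def vec_eq_iff)

text \<open>At \<open>join_vec u w\<close> the form is \<open>(norm u)\<^sup>2 + (norm w)\<^sup>2 +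
  2 * (u \<bullet> (M *v w))\<close>. Unit vectors give one direction, the inequality between
  arithmetic and geometric mean the other.\<close>

lemma psd_block_mat_iff:
  fixes M :: "real^'n^'m"
  shows "psd (block_mat (mat 1) M (transpose M) (mat 1)) \<longleftrightarrow> onorm ((*v) M) \<le> 1"
    (is "psd ?B \<longleftrightarrow> _")
proof -
  have quad: "join_vec u w \<bullet> (?B *v join_vec u w) = (norm u)\<^sup>2 + (norm w)\<^sup>2 + 2 * (u \<bullet> (M *v w))"
    for u w
    by (simp add: block_mat_mult_join_vec inner_join_vec inner_add_right power2_norm_eq_inner
        inner_commute dot_lmul_matrix[symmetric] transpose_matrix_vector)
  have sym: "transpose ?B = ?B"
    by (auto simp: vec_eq_iff transpose_def block_mat_def mat_def split: sum.split)
  show ?thesis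
  proof
    assume psd: "psd ?B"
    have "u \<bullet> (M *v w) \<le> 1" if "norm u = 1" "norm w = 1" for u w
    proof -
      \<comment> \<open>The sign turns the lower bound on the mixed term into the required upper
        bound.\<close>
      have "0 \<le> join_vec (-u) w \<bullet> (?B *v join_vec (-u) w)"
        using psd unfolding psd_def by blast
      then show ?thesis using that unfolding quad by simp
    qed
    then show "onorm ((*v) M) \<le> 1" by (subst onorm_matrix_le_iff) auto
  next
    assume le: "onorm ((*v) M) \<le> 1"
    have "0 \<le> v \<bullet> (?B *v v)" for v
    proof -
      obtain u w where v: "v = join_vec u w" by (rule join_vec_split)
      have "norm (M *v w) \<le> onorm ((*v) M) * norm w"
        by (rule onorm[OF matrix_vector_mul_bounded_linear])
      also have "\<dots> \<le> norm w" using mult_right_mono[OF le, of "norm w"] by simp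
      finally have "norm u * norm (M *v w) \<le> norm u * norm w" by (intro mult_left_mono) auto
      moreover have "\<bar>u \<bullet> (M *v w)\<bar> \<le> norm u * norm (M *v w)" by (rule Cauchy_Schwarz_ineq2)
      moreover have "0 \<le> (norm u - norm w)\<^sup>2" by simp
      ultimately show ?thesis unfolding v quad power2_diff by linarith
    qed
    then show "psd ?B" using sym unfolding psd_def by blast
  qed
qed

section \<open>The tensor nuclear norm\<close>

text \<open>The link between tensor duality and the matrix constraints; both sides are the same
  triple sum in different orders.\<close>

lemma inner_outer3: "Z \<bullet> outer3 x u w = u \<bullet> (contract Z x *v w)"
proof -
  have "contract Z x $ i $ k = (\<Sum>j\<in>UNIV. x $ j * Z $ j $ i $ k)" for i k
    by (simp add: contract_def)
  then have "u \<bullet> (contract Z x *v w)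
      = (\<Sum>i\<in>UNIV. \<Sum>k\<in>UNIV. \<Sum>j\<in>UNIV. Z $ j $ i $ k * (x $ j * u $ i * w $ k))"
    by (simp add: inner_vec_def matrix_vector_mult_def sum_distrib_left sum_distrib_right mult_ac)
  also have "\<dots> = (\<Sum>i\<in>UNIV. \<Sum>j\<in>UNIV. \<Sum>k\<in>UNIV. Z $ j $ i $ k * (x $ j * u $ i * w $ k))"
    by (intro sum.cong sum.swap refl)
  also have "\<dots> = (\<Sum>j\<in>UNIV. \<Sum>i\<in>UNIV. \<Sum>k\<in>UNIV. Z $ j $ i $ k * (x $ j * u $ i * w $ k))"
    by (rule sum.swap)
  also have "\<dots> = Z \<bullet> outer3 x u w"
    by (simp add: inner_vec_def outer3_def)
  finally show ?thesis by simp
qed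

lemma outer3_scaleR:
  "outer3 (a *\<^sub>R x) y z = a *\<^sub>R outer3 x y z"
  "outer3 x (a *\<^sub>R y) z = a *\<^sub>R outer3 x y z"
  "outer3 x y (a *\<^sub>R z) = a *\<^sub>R outer3 x y z"
  by (simp_all add: outer3_def vec_eq_iff)

lemma outer_mat_rank1: "outer_mat x (rank1 u v) = outer3 x u v"
  by (simp add: outer_mat_def rank1_def outer3_def vec_eq_iff mult_ac)

lemma linear_outer_mat: "linear (outer_mat x)"
  by (rule linearI) (simp_all add: outer_mat_def vec_eq_iff algebra_simps)

lemma linear_corner: "linear corner"
  by (rule linearI) (simp_all add: corner_def vec_eq_iff)

lemma linear_measure_map: "linear (measure_map A)"
  by (rule linearI) (simp_all add: measure_map_def vec_eq_iff inner_add_right)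

lemma linear_trace: "linear (trace :: real^'n^'n \<Rightarrow> real)"
  by (rule linearI) (simp_all add: trace_def sum.distrib sum_distrib_left)

text \<open>The set whose infimum is the nuclear norm, named so that norm inequalities reduce to
  membership statements.\<close>

definition decomposition_costs :: "real^'n3^'n2^'n1 \<Rightarrow> real set" where
  "decomposition_costs T = {(\<Sum>r<R. \<bar>c r\<bar>) | R c x y z.
     (\<forall>r<R. norm (x r) = 1 \<and> norm (y r) = 1 \<and> norm (z r) = 1) \<and>
     T = (\<Sum>r<(R::nat). c r *\<^sub>R outer3 (x r) (y r) (z r))}"

lemma tensor_nuclear_norm_eq_Inf: "tensor_nuclear_norm T = Inf (decomposition_costs T)"
  by (simp add: tensor_nuclear_norm_def decomposition_costs_def)

lemma decomposition_costsD:
  assumes "a \<in> decomposition_costs T"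
  shows "\<exists>R c x y z. (\<forall>r<R. norm (x r) = 1 \<and> norm (y r) = 1 \<and> norm (z r) = 1) \<and>
     T = (\<Sum>r<(R::nat). c r *\<^sub>R outer3 (x r) (y r) (z r)) \<and> a = (\<Sum>r<R. \<bar>c r\<bar>)"
  using assms unfolding decomposition_costs_def by blast

lemma zero_in_decomposition_costs: "0 \<in> decomposition_costs 0"
  unfolding decomposition_costs_def by (rule CollectI) (intro exI[of _ 0], simp)

lemma decomposition_costs_add_term:
  assumes "a \<in> decomposition_costs T" "norm x = 1" "norm y = 1" "norm z = 1"
  shows "a + \<bar>c\<bar> \<in> decomposition_costs (T + c *\<^sub>R outer3 x y z)"
proof -
  obtain R c' x' y' z' where *:
    "\<forall>r<(R::nat). norm (x' r) = 1 \<and> norm (y' r) = 1 \<and> norm (z' r) = 1"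
    "T = (\<Sum>r<R. c' r *\<^sub>R outer3 (x' r) (y' r) (z' r))" "a = (\<Sum>r<R. \<bar>c' r\<bar>)"
    using decomposition_costsD[OF assms(1)] by blast
  show ?thesis
    unfolding decomposition_costs_def
    by (intro CollectI exI[of _ "Suc R"] exI[of _ "c'(R := c)"] exI[of _ "x'(R := x)"]
        exI[of _ "y'(R := y)"] exI[of _ "z'(R := z)"])
      (use * assms in \<open>simp add: less_Suc_eq\<close>)
qed

text \<open>The terms of a decomposition of \<open>T\<close> are appended one by one to a
  decomposition of \<open>S\<close>.\<close>

lemma decomposition_costs_add:
  assumes "a \<in> decomposition_costs S" "b \<in> decomposition_costs T"
  shows "a + b \<in> decomposition_costs (S + T)"
proof -
  obtain R c x y z where *:
    "\<forall>r<(R::nat). norm (x r) = 1 \<and> norm (y r) = 1 \<and> norm (z r) = 1"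
    and T: "T = (\<Sum>r<R. c r *\<^sub>R outer3 (x r) (y r) (z r))" "b = (\<Sum>r<R. \<bar>c r\<bar>)"
    using decomposition_costsD[OF assms(2)] by blast
  have "a + (\<Sum>r<R. \<bar>c r\<bar>)
      \<in> decomposition_costs (S + (\<Sum>r<R. c r *\<^sub>R outer3 (x r) (y r) (z r)))"
    using *
  proof (induction R)
    case 0
    then show ?case using assms(1) by simp
  next
    case (Suc R)
    then show ?case
      using decomposition_costs_add_term[of _ _ "x R" "y R" "z R" "c R"]
      by (simp add: add.assoc[symmetric])
  qed
  then show ?thesis using T by simp
qed

text \<open>The norms of the factors move into the coefficient. A zero factor cannot be normalized,
  but then the tensor is zero and has the empty decomposition.\<close>

lemma decomposition_costs_outer3:
  "norm x * norm y * norm z \<in> decomposition_costs (outer3 x y z)"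
proof (cases "x = 0 \<or> y = 0 \<or> z = 0")
  case True
  then have "outer3 x y z = 0" by (auto simp: outer3_def vec_eq_iff)
  then show ?thesis using True zero_in_decomposition_costs by auto
next
  case False
  have "outer3 x y z = outer3 (norm x *\<^sub>R sgn x) (norm y *\<^sub>R sgn y) (norm z *\<^sub>R sgn z)"
    using False by (simp add: sgn_div_norm)
  then have "outer3 x y z = (norm x * norm y * norm z) *\<^sub>R outer3 (sgn x) (sgn y) (sgn z)"
    by (simp add: outer3_scaleR mult_ac)
  then show ?thesis
    using decomposition_costs_add_term[OF zero_in_decomposition_costs, of "sgn x" "sgn y" "sgn z"
        "norm x * norm y * norm z"] False
    by (simp add: norm_sgn)
qed

lemma decomposition_costs_sum_nonempty:
  assumes "\<And>i. i \<in> I \<Longrightarrow> decomposition_costs (T i) \<noteq> {}"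
  shows "decomposition_costs (\<Sum>i\<in>I. T i) \<noteq> {}"
  using assms
proof (induction I rule: infinite_finite_induct)
  case (insert i I)
  then have "decomposition_costs (T i) \<noteq> {}" "decomposition_costs (sum T I) \<noteq> {}"
    by simp_all
  then obtain a b where "a \<in> decomposition_costs (T i)" "b \<in> decomposition_costs (sum T I)"
    by blast
  then have "a + b \<in> decomposition_costs (\<Sum>i\<in>insert i I. T i)"
    using decomposition_costs_add insert.hyps by simp
  then show ?case by blast
qed (use zero_in_decomposition_costs in auto)

text \<open>Every tensor is a sum of products of two basis vectors with a mode-three fiber, so the
  infimum is over a nonempty set.\<close>

lemma decomposition_costs_nonempty: "decomposition_costs T \<noteq> {}"
proof -
  have "T = (\<Sum>i\<in>UNIV. \<Sum>j\<in>UNIV. outer3 (axis i 1) (axis j 1) (T $ i $ j))"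
  proof (simp add: vec_eq_iff, intro allI)
    fix i' j' k
    have "(\<Sum>i\<in>UNIV. \<Sum>j\<in>UNIV. outer3 (axis i 1) (axis j 1) (T $ i $ j) $ i' $ j' $ k)
        = (\<Sum>i\<in>UNIV. \<Sum>j\<in>UNIV. if i = i' then if j = j' then T $ i $ j $ k else 0 else 0)"
      by (intro sum.cong refl) (simp add: outer3_def axis_def)
    also have "\<dots> = T $ i' $ j' $ k"
    proof -
      have "(\<Sum>j\<in>UNIV. if i = i' then if j = j' then T $ i $ j $ k else 0 else 0)
          = (if i = i' then T $ i $ j' $ k else 0)" for i
        by simp
      then show ?thesis by simp
    qed
    finally show "T $ i' $ j' $ k
      = (\<Sum>i\<in>UNIV. \<Sum>j\<in>UNIV. outer3 (axis i 1) (axis j 1) (T $ i $ j) $ i' $ j' $ k)" by simp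
  qed
  moreover have "decomposition_costs \<dots> \<noteq> {}"
    using decomposition_costs_outer3 by (intro decomposition_costs_sum_nonempty) blast
  ultimately show ?thesis by simp
qed

lemma decomposition_costs_bdd_below: "bdd_below (decomposition_costs T)"
  by (rule bdd_belowI[of _ 0]) (auto simp: decomposition_costs_def intro: sum_nonneg)

lemma tensor_nuclear_norm_nonneg: "0 \<le> tensor_nuclear_norm T"
  unfolding tensor_nuclear_norm_eq_Inf
  by (rule cInf_greatest[OF decomposition_costs_nonempty])
    (auto simp: decomposition_costs_def intro: sum_nonneg)

lemma tensor_nuclear_norm_outer3_le: "tensor_nuclear_norm (outer3 x y z) \<le> norm x * norm y * norm z"
  unfolding tensor_nuclear_norm_eq_Inf
  by (intro cInf_lower decomposition_costs_outer3 decomposition_costs_bdd_below)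

lemma tensor_nuclear_norm_0: "tensor_nuclear_norm 0 = 0"
proof (rule antisym)
  show "tensor_nuclear_norm 0 \<le> 0"
    unfolding tensor_nuclear_norm_eq_Inf
    by (intro cInf_lower zero_in_decomposition_costs decomposition_costs_bdd_below)
qed (rule tensor_nuclear_norm_nonneg)

text \<open>Costs of decompositions add; the infimum is taken first over those of \<open>S\<close>
  with the cost for \<open>T\<close> fixed, then over those of \<open>T\<close>.\<close>

lemma tensor_nuclear_norm_triangle:
  "tensor_nuclear_norm (S + T) \<le> tensor_nuclear_norm S + tensor_nuclear_norm T"
proof -
  have "tensor_nuclear_norm (S + T) \<le> a + b"
    if "a \<in> decomposition_costs S" "b \<in> decomposition_costs T" for a b
    unfolding tensor_nuclear_norm_eq_Inf
    by (intro cInf_lower decomposition_costs_add decomposition_costs_bdd_below that)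
  then have "tensor_nuclear_norm (S + T) - b \<le> tensor_nuclear_norm S"
    if "b \<in> decomposition_costs T" for b
    unfolding tensor_nuclear_norm_eq_Inf[of S]
    using that by (intro cInf_greatest decomposition_costs_nonempty) (simp add: diff_le_eq)
  then have "tensor_nuclear_norm (S + T) - tensor_nuclear_norm S \<le> tensor_nuclear_norm T"
    unfolding tensor_nuclear_norm_eq_Inf[of T]
    by (intro cInf_greatest decomposition_costs_nonempty) (simp add: algebra_simps)
  then show ?thesis by simp
qed

lemma tensor_nuclear_norm_sum: "tensor_nuclear_norm (\<Sum>i\<in>I. T i) \<le> (\<Sum>i\<in>I. tensor_nuclear_norm (T i))"
proof (induction I rule: infinite_finite_induct)
  case (insert i I)
  then show ?case
    using tensor_nuclear_norm_triangle[of "T i" "sum T I"] by simp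
qed (simp_all add: tensor_nuclear_norm_0)

text \<open>In any decomposition of \<open>T\<close>, each term contributes at most
  \<open>\<bar>c r\<bar>\<close> to the pairing with \<open>Z\<close>.\<close>

lemma inner_le_tensor_nuclear_norm:
  assumes "\<And>x y z. norm x = 1 \<Longrightarrow> norm y = 1 \<Longrightarrow> norm z = 1 \<Longrightarrow> Z \<bullet> outer3 x y z \<le> 1"
  shows "Z \<bullet> T \<le> tensor_nuclear_norm T"
  unfolding tensor_nuclear_norm_eq_Inf
proof (rule cInf_greatest[OF decomposition_costs_nonempty])
  fix a assume a: "a \<in> decomposition_costs T"
  obtain R c x y z where *:
    "\<forall>r<(R::nat). norm (x r) = 1 \<and> norm (y r) = 1 \<and> norm (z r) = 1"
    and T: "T = (\<Sum>r<R. c r *\<^sub>R outer3 (x r) (y r) (z r))" "a = (\<Sum>r<R. \<bar>c r\<bar>)"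
    using decomposition_costsD[OF a] by blast
  \<comment> \<open>Replacing \<open>y r\<close> by its negative upgrades the one-sided hypothesis
    to a bound on the absolute value.\<close>
  have bound: "\<bar>Z \<bullet> outer3 (x r) (y r) (z r)\<bar> \<le> 1" if "r < R" for r
    using assms[of "x r" "y r" "z r"] assms[of "x r" "- y r" "z r"] * that
      outer3_scaleR(2)[of "x r" "-1" "y r" "z r"]
    by (simp add: abs_le_iff)
  have "Z \<bullet> T = (\<Sum>r<R. c r * (Z \<bullet> outer3 (x r) (y r) (z r)))"
    by (simp add: T inner_sum_right)
  also have "\<dots> \<le> (\<Sum>r<R. \<bar>c r\<bar>)"
  proof (rule sum_mono)
    fix r assume "r \<in> {..<R}"
    then have "\<bar>c r\<bar> * \<bar>Z \<bullet> outer3 (x r) (y r) (z r)\<bar> \<le> \<bar>c r\<bar> * 1"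
      by (intro mult_left_mono bound) auto
    then show "c r * (Z \<bullet> outer3 (x r) (y r) (z r)) \<le> \<bar>c r\<bar>"
      using abs_ge_self[of "c r * (Z \<bullet> outer3 (x r) (y r) (z r))"] unfolding abs_mult by linarith
  qed
  finally show "Z \<bullet> T \<le> a" by (simp add: T)
qed

text \<open>A rank-one summand of \<open>L\<close> generated by \<open>join_vec u v\<close>
  contributes \<open>outer3 x u v\<close>, of nuclear norm at most \<open>norm u * norm v\<close>,
  which is at most half of \<open>(norm u)\<^sup>2 + (norm v)\<^sup>2\<close>, its half
  trace.\<close>

lemma tensor_nuclear_norm_outer_mat_corner_le:
  assumes "norm x = 1" "psd L"
  shows "tensor_nuclear_norm (outer_mat x (corner L)) \<le> 1/2 * trace L"
proof -
  obtain N w where L: "L = (\<Sum>k<(N::nat). rank1 (w k) (w k))"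
    using psd_sum_rank1[OF assms(2)] by blast
  have "\<forall>k. \<exists>u v. w k = join_vec u v"
    using join_vec_split by blast
  then obtain u v where w: "\<And>k. w k = join_vec (u k) (v k)"
    unfolding choice_iff by blast
  have "outer_mat x (corner L) = (\<Sum>k<N. outer3 x (u k) (v k))"
    by (simp add: L linear_sum[OF linear_corner] linear_sum[OF linear_outer_mat] w corner_rank1
        outer_mat_rank1)
  then have "tensor_nuclear_norm (outer_mat x (corner L))
      \<le> (\<Sum>k<N. tensor_nuclear_norm (outer3 x (u k) (v k)))"
    by (simp add: tensor_nuclear_norm_sum)
  also have "\<dots> \<le> (\<Sum>k<N. 1/2 * trace (rank1 (w k) (w k)))"
  proof (rule sum_mono)
    fix k
    have "0 \<le> (norm (u k) - norm (v k))\<^sup>2" by simp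
    then show "tensor_nuclear_norm (outer3 x (u k) (v k)) \<le> 1/2 * trace (rank1 (w k) (w k))"
      using tensor_nuclear_norm_outer3_le[of x "u k" "v k"] assms(1)
      unfolding w trace_rank1 norm_join_vec power2_diff by simp
  qed
  also have "\<dots> = 1/2 * trace L"
    by (simp add: L linear_sum[OF linear_trace] sum_distrib_left)
  finally show ?thesis .
qed

section \<open>Duality\<close>

lemma dual_feasible_iff:
  "dual_feasible A X (lam, Z) \<longleftrightarrow>
     (\<forall>x\<in>X. onorm ((*v) (contract Z x)) \<le> 1) \<and> Z = (\<Sum>l\<in>UNIV. lam $ l *\<^sub>R A l)"
  by (simp add: dual_feasible_def psd_block_mat_iff)

lemma dual_feasible_iff_outer3:
  "dual_feasible A X (lam, Z) \<longleftrightarrow>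
     (\<forall>x\<in>X. \<forall>u w. norm u = 1 \<longrightarrow> norm w = 1 \<longrightarrow> Z \<bullet> outer3 x u w \<le> 1) \<and>
     Z = (\<Sum>l\<in>UNIV. lam $ l *\<^sub>R A l)"
  by (simp add: dual_feasible_iff onorm_matrix_le_iff inner_outer3)

lemma inner_measure_map: "lam \<bullet> measure_map A T = (\<Sum>l\<in>UNIV. lam $ l *\<^sub>R A l) \<bullet> T"
  by (simp add: measure_map_def inner_vec_def[of lam] inner_sum_left)

text \<open>The constraint on the whole sphere is what the pairing bound asks for, since a
  decomposition of \<open>T\<close> may use any unit vector as first factor.\<close>

lemma weak_duality:
  assumes "dual_feasible A (sphere 0 1) (lam, Z)" "tnn_feasible A b T"
  shows "lam \<bullet> b \<le> tensor_nuclear_norm T"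
proof -
  have "lam \<bullet> b = Z \<bullet> T"
    using assms by (simp add: tnn_feasible_def dual_feasible_iff_outer3 inner_measure_map[symmetric])
  also have "\<dots> \<le> tensor_nuclear_norm T"
    using assms(1) unfolding dual_feasible_iff_outer3 by (intro inner_le_tensor_nuclear_norm) auto
  finally show ?thesis .
qed

lemma dual_feasible_0: "dual_feasible A X (0, 0)"
  by (simp add: dual_feasible_iff_outer3)

lemma dual_optimal_iff:
  "dual_optimal A b X (lam, Z) \<longleftrightarrow>
     dual_feasible A X (lam, Z) \<and> (\<forall>lam' Z'. dual_feasible A X (lam', Z') \<longrightarrow> lam' \<bullet> b \<le> lam \<bullet> b)"
  by (auto simp: dual_optimal_def is_arg_max_linorder)

lemma dual_optimal_nonneg: "dual_optimal A b X (lam, Z) \<Longrightarrow> 0 \<le> lam \<bullet> b"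
  using dual_feasible_0[of A X] by (fastforce simp: dual_optimal_iff)

lemma dual_feasible_antimono: "dual_feasible A Y p \<Longrightarrow> X \<subseteq> Y \<Longrightarrow> dual_feasible A X p"
  by (auto simp: dual_feasible_def)

lemma tensor_nuclear_norm_primal_feasible_le:
  assumes "primal_feasible A b X (T, Lam)" "X \<subseteq> sphere 0 1"
  shows "tensor_nuclear_norm T \<le> 1/2 * (\<Sum>x\<in>X. trace (Lam x))"
proof -
  have T: "T = (\<Sum>x\<in>X. outer_mat x (corner (Lam x)))" and psd: "\<And>x. x \<in> X \<Longrightarrow> psd (Lam x)"
    using assms(1) by (auto simp: primal_feasible_def)
  have "tensor_nuclear_norm T \<le> (\<Sum>x\<in>X. tensor_nuclear_norm (outer_mat x (corner (Lam x))))"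
    unfolding T by (rule tensor_nuclear_norm_sum)
  also have "\<dots> \<le> (\<Sum>x\<in>X. 1/2 * trace (Lam x))"
    using assms(2) psd by (intro sum_mono tensor_nuclear_norm_outer_mat_corner_le) auto
  finally show ?thesis by (simp add: sum_distrib_left)
qed

lemma continuous_on_outer3:
  "continuous_on S (\<lambda>p. outer3 (fst p) (fst (snd p)) (snd (snd p)))"
  unfolding outer3_def by (intro continuous_intros)

text \<open>If \<open>b\<close> were outside \<open>mu\<close> times the convex hull of the measured rank-one tensors supported on
  \<open>X\<close>, a separating functional, suitably scaled, would be a dual feasible point of value more than
  \<open>mu\<close>.\<close>

lemma discrete_strong_duality:
  fixes A :: "'d::finite \<Rightarrow> real^'n3^'n2^'n1"
  assumes "finite X" "dual_optimal A b X (lam, Z)" "lam \<bullet> b < mu"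
  shows "\<exists>T Lam. primal_feasible A b X (T, Lam) \<and> 1/2 * (\<Sum>x\<in>X. trace (Lam x)) \<le> mu"
proof -
  \<comment> \<open>The zero point is dual feasible, so the optimal value is nonnegative and
    division by \<open>mu\<close> is allowed.\<close>
  have mu: "0 < mu" using dual_optimal_nonneg[OF assms(2)] assms(3) by simp
  define G where "G = (\<lambda>p. measure_map A (outer3 (fst p) (fst (snd p)) (snd (snd p)))) `
    (X \<times> sphere 0 1 \<times> sphere 0 1)"
  define H where "H = convex hull (insert 0 G)"
  define \<Phi> where "\<Phi> = (\<lambda>Lam. measure_map A (\<Sum>x\<in>X. outer_mat x (corner (Lam x))))"
  define tr where "tr = (\<lambda>Lam :: real^'n1 \<Rightarrow> real^('n2 + 'n3)^('n2 + 'n3). 1/2 * (\<Sum>x\<in>X. trace (Lam x)))"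
  \<comment> \<open>\<open>Q\<close> collects the measurements produced by matrix families of cost
    at most \<open>1\<close>. It is convex and contains the generators of \<open>H\<close>; the
    separation itself uses \<open>H\<close>, which is compact.\<close>
  define Q where "Q = {\<Phi> Lam | Lam. (\<forall>x\<in>X. psd (Lam x)) \<and> tr Lam \<le> 1}"
  note lin = linear_outer_mat linear_corner linear_measure_map linear_trace
  have \<Phi>_lin: "\<Phi> (\<lambda>x. s *\<^sub>R L x + t *\<^sub>R L' x) = s *\<^sub>R \<Phi> L + t *\<^sub>R \<Phi> L'" for s t L L'
    by (simp add: \<Phi>_def lin[THEN linear_add] lin[THEN linear_scale] sum.distrib scaleR_sum_right[symmetric])
  have tr_lin: "tr (\<lambda>x. s *\<^sub>R L x + t *\<^sub>R L' x) = s * tr L + t * tr L'" for s t L L'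
    by (simp add: tr_def lin[THEN linear_add] lin[THEN linear_scale] sum.distrib sum_distrib_left[symmetric]
        algebra_simps)
  have "compact G"
    unfolding G_def
    by (intro compact_continuous_image compact_Times finite_imp_compact assms(1) compact_sphere
        linear_continuous_on_compose[OF continuous_on_outer3] linear_measure_map)
  then have "compact H"
    unfolding H_def by (intro compact_convex_hull compact_insert)
  have "convex Q"
    unfolding convex_def
  proof (intro ballI allI impI)
    fix p q s t assume "p \<in> Q" "q \<in> Q" and st: "0 \<le> s" "0 \<le> t" "s + t = (1::real)"
    then obtain L L' where L: "p = \<Phi> L" "\<forall>x\<in>X. psd (L x)" "tr L \<le> 1"
      and L': "q = \<Phi> L'" "\<forall>x\<in>X. psd (L' x)" "tr L' \<le> 1"
      unfolding Q_def by blast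
    have "s * tr L + t * tr L' \<le> s * 1 + t * 1"
      using L L' st by (intro add_mono mult_left_mono) auto
    then show "s *\<^sub>R p + t *\<^sub>R q \<in> Q"
      unfolding Q_def using L L' st
      by (intro CollectI exI[of _ "\<lambda>x. s *\<^sub>R L x + t *\<^sub>R L' x"])
        (auto simp: \<Phi>_lin tr_lin intro!: psd_add psd_scaleR)
  qed
  moreover have "insert 0 G \<subseteq> Q"
  proof
    fix g assume "g \<in> insert 0 G"
    then consider "g = 0" | x u w where "x \<in> X" "norm u = 1" "norm w = 1"
      "g = measure_map A (outer3 x u w)"
      unfolding G_def by auto
    then show "g \<in> Q"
    proof cases
      case 1
      then show ?thesis
        unfolding Q_def
        by (intro CollectI exI[of _ "\<lambda>x. 0"])
          (simp add: \<Phi>_def tr_def psd_0 lin[THEN linear_0])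
    next
      case 2
      \<comment> \<open>One rank-one block matrix at \<open>x\<close>, zero elsewhere: its trace is
        \<open>1 + 1\<close>, so the halved cost is \<open>1\<close>.\<close>
      let ?L = "\<lambda>y. if y = x then rank1 (join_vec u w) (join_vec u w) else 0"
      have "\<Phi> ?L = g"
        using 2 assms(1)
        by (simp add: \<Phi>_def if_distrib[of corner] if_distrib[of "outer_mat _"] lin[THEN linear_0]
            corner_rank1 outer_mat_rank1 cong: if_cong)
      moreover have "tr ?L \<le> 1"
        using 2 assms(1)
        by (simp add: tr_def if_distrib[of trace] lin[THEN linear_0] trace_rank1 norm_join_vec
            cong: if_cong)
      ultimately show ?thesis
        unfolding Q_def by (intro CollectI exI[of _ ?L]) (auto simp: psd_rank1 psd_0)
    qed
  qed
  ultimately have "H \<subseteq> Q"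
    unfolding H_def by (intro hull_minimal)
  have "(1 / mu) *\<^sub>R b \<in> H"
  proof (rule ccontr)
    assume outside: "(1 / mu) *\<^sub>R b \<notin> H"
    have "convex H" "closed H"
      using \<open>compact H\<close> by (auto simp: H_def compact_imp_closed)
    from separating_hyperplane_closed_point[OF this outside] obtain a c where ac: "a \<bullet> ((1 / mu) *\<^sub>R b) < c" "\<And>h. h \<in> H \<Longrightarrow> a \<bullet> h > c"
      by blast
    \<comment> \<open>Since zero was put into the hull, \<open>c < 0\<close>. Dividing by
      \<open>c\<close> reverses both strict inequalities: the functional is at most \<open>1\<close>
      on \<open>G\<close> and exceeds \<open>mu\<close> at \<open>b\<close>.\<close>
    have hull: "insert 0 G \<subseteq> H" unfolding H_def by (rule hull_subset)
    then have c: "c < 0" using ac(2)[of 0] by auto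
    define lam' where "lam' = (1 / c) *\<^sub>R a"
    have "lam' \<bullet> measure_map A (outer3 x u w) \<le> 1"
      if "x \<in> X" "norm u = 1" "norm w = 1" for x u w
    proof -
      have "measure_map A (outer3 x u w) \<in> G"
        unfolding G_def using that by (intro image_eqI[of _ _ "(x, u, w)"]) auto
      then have "a \<bullet> measure_map A (outer3 x u w) > c" using ac(2) hull by auto
      then show ?thesis using c by (simp add: lam'_def divide_le_eq)
    qed
    then have "dual_feasible A X (lam', \<Sum>l\<in>UNIV. lam' $ l *\<^sub>R A l)"
      by (simp add: dual_feasible_iff_outer3 inner_measure_map)
    then have "lam' \<bullet> b \<le> lam \<bullet> b" using assms(2) unfolding dual_optimal_iff by blast
    moreover have "lam' \<bullet> b > mu"
      using ac(1) c mu by (simp add: lam'_def field_simps)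
    ultimately show False using assms(3) by simp
  qed
  with \<open>H \<subseteq> Q\<close> obtain L where L: "(1 / mu) *\<^sub>R b = \<Phi> L" "\<forall>x\<in>X. psd (L x)" "tr L \<le> 1"
    unfolding Q_def by blast
  define Lam where "Lam = (\<lambda>x. mu *\<^sub>R L x)"
  have "\<Phi> Lam = mu *\<^sub>R \<Phi> L" "tr Lam = mu * tr L"
    using \<Phi>_lin[of mu L 0 L] tr_lin[of mu L 0 L] by (simp_all add: Lam_def)
  then have "\<Phi> Lam = b" "tr Lam \<le> mu"
    using L(3) mu by (simp_all add: L(1)[symmetric])
  moreover have "\<forall>x\<in>X. psd (Lam x)"
    using L(2) mu by (simp add: Lam_def psd_scaleR)
  ultimately have "primal_feasible A b X (\<Sum>x\<in>X. outer_mat x (corner (Lam x)), Lam)"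
    "1/2 * (\<Sum>x\<in>X. trace (Lam x)) \<le> mu"
    by (simp_all add: primal_feasible_def \<Phi>_def tr_def)
  then show ?thesis by blast
qed

lemma primal_optimal_tnn_feasible: "primal_optimal A b X (T, Lam) \<Longrightarrow> tnn_feasible A b T"
  by (auto simp: primal_optimal_def is_arg_min_def primal_feasible_def tnn_feasible_def)

text \<open>For each \<open>mu\<close> above the dual value, \<open>T\<close> is compared with a
  primal feasible point of cost at most \<open>mu\<close>; density then removes the slack.\<close>

lemma primal_optimal_nuclear_norm_le:
  assumes "finite X" "X \<subseteq> sphere 0 1" "dual_optimal A b X (lam, Z)" "primal_optimal A b X (T, Lam)"
  shows "tensor_nuclear_norm T \<le> lam \<bullet> b"
proof (rule dense_ge)
  fix mu assume "lam \<bullet> b < mu"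
  then obtain T' Lam' where *: "primal_feasible A b X (T', Lam')"
      "1/2 * (\<Sum>x\<in>X. trace (Lam' x)) \<le> mu"
    using discrete_strong_duality[OF assms(1,3)] by blast
  have "tensor_nuclear_norm T \<le> 1/2 * (\<Sum>x\<in>X. trace (Lam x))"
    using assms(2,4) by (intro tensor_nuclear_norm_primal_feasible_le)
      (auto simp: primal_optimal_def is_arg_min_def)
  also have "\<dots> \<le> 1/2 * (\<Sum>x\<in>X. trace (Lam' x))"
    using assms(4) *(1) unfolding primal_optimal_def is_arg_min_linorder by fastforce
  finally show "tensor_nuclear_norm T \<le> mu" using *(2) by simp
qed

section \<open>Convergence of the adaptive algorithm\<close>

lemma linear_contract: "linear (contract Z)"
  by (rule linearI; simp add: contract_def vec_eq_iff sum.distrib sum_distrib_left algebra_simps)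

lemma contract_diff_left: "contract (Z - Z') x = contract Z x - contract Z' x"
  by (simp add: contract_def vec_eq_iff sum_subtractf algebra_simps)

lemma contract_axis: "contract Z (axis j 1) = Z $ j"
proof -
  have "contract Z (axis j 1) = (\<Sum>i\<in>UNIV. if i = j then Z $ i else 0)"
    unfolding contract_def by (intro sum.cong refl) (simp add: axis_def)
  then show ?thesis by simp
qed

lemma onorm_matrix_triangle:
  fixes M N :: "real^'n^'m"
  shows "onorm ((*v) (M + N)) \<le> onorm ((*v) M) + onorm ((*v) N)"
proof -
  have "(*v) (M + N) = (\<lambda>x. M *v x + N *v x)"
    by (simp add: fun_eq_iff matrix_vector_mult_add_rdistrib)
  then show ?thesis
    by (simp add: onorm_triangle matrix_vector_mul_bounded_linear)
qed

lemma onorm_matrix_scaleR: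
  fixes M :: "real^'n^'m"
  shows "onorm ((*v) (c *\<^sub>R M)) = \<bar>c\<bar> * onorm ((*v) M)"
proof -
  have "(*v) (c *\<^sub>R M) = (\<lambda>x. c *\<^sub>R (M *v x))"
    by (simp add: fun_eq_iff scaleR_matrix_vector_assoc)
  then show ?thesis
    by (simp add: onorm_scaleR matrix_vector_mul_bounded_linear)
qed

lemma onorm_matrix_le_sum:
  fixes M :: "real^'n^'m"
  shows "onorm ((*v) M) \<le> (\<Sum>i\<in>UNIV. norm (M $ i))"
proof (rule onorm_le)
  fix v
  have "norm (M *v v) \<le> (\<Sum>i\<in>UNIV. \<bar>(M *v v) $ i\<bar>)" by (rule norm_le_l1_cart)
  also have "\<dots> \<le> (\<Sum>i\<in>UNIV. norm (M $ i) * norm v)"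
    by (intro sum_mono) (simp add: matrix_vector_mul_component Cauchy_Schwarz_ineq2)
  finally show "norm (M *v v) \<le> (\<Sum>i\<in>UNIV. norm (M $ i)) * norm v"
    by (simp add: sum_distrib_right)
qed

lemma entry_le_onorm_matrix:
  fixes M :: "real^'n^'m"
  shows "\<bar>M $ i $ j\<bar> \<le> onorm ((*v) M)"
proof -
  have "\<bar>M $ i $ j\<bar> \<le> norm (M *v axis j 1)"
    using component_le_norm_cart[of "M *v axis j 1" i] by (simp add: matrix_vector_mult_basis column_def)
  also have "\<dots> \<le> onorm ((*v) M)"
    using onorm[OF matrix_vector_mul_bounded_linear, of M "axis j 1"] by simp
  finally show ?thesis .
qed

lemma onorm_contract_le_near:
  "onorm ((*v) (contract Z x))
     \<le> onorm ((*v) (contract Z' x)) + onorm ((*v) (contract (Z - Z') x))"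
  using onorm_matrix_triangle[of "contract Z' x" "contract (Z - Z') x"]
  by (simp add: contract_diff_left)

text \<open>A crude constant suffices: being uniform over the unit sphere, the bound turns
  convergence of tensors into uniform convergence of these norms.\<close>

lemma onorm_contract_le:
  fixes Z :: "real^'n3^'n2^'n1"
  assumes x: "norm x = 1"
  shows "onorm ((*v) (contract Z x)) \<le> real CARD('n2) * real CARD('n1) * norm Z"
proof -
  have "norm (contract Z x) \<le> (\<Sum>j\<in>UNIV. norm (x $ j *\<^sub>R Z $ j))"
    unfolding contract_def by (rule norm_sum)
  also have "\<dots> \<le> (\<Sum>j\<in>(UNIV::'n1 set). norm Z)"
  proof (rule sum_mono)
    fix j
    have "\<bar>x $ j\<bar> \<le> 1" using component_le_norm_cart[of x j] x by simp
    then have "\<bar>x $ j\<bar> * norm (Z $ j) \<le> 1 * norm Z"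
      by (intro mult_mono Finite_Cartesian_Product.norm_nth_le) auto
    then show "norm (x $ j *\<^sub>R Z $ j) \<le> norm Z" by simp
  qed
  finally have c: "norm (contract Z x) \<le> real CARD('n1) * norm Z" by simp
  have "onorm ((*v) (contract Z x)) \<le> (\<Sum>i\<in>(UNIV::'n2 set). norm (contract Z x $ i))"
    by (rule onorm_matrix_le_sum)
  also have "\<dots> \<le> (\<Sum>i\<in>(UNIV::'n2 set). norm (contract Z x))"
    by (intro sum_mono Finite_Cartesian_Product.norm_nth_le)
  also have "\<dots> \<le> real CARD('n2) * (real CARD('n1) * norm Z)"
    using c by simp
  finally show ?thesis by simp
qed

text \<open>The hypotheses express linear independence of the family, so the coefficient map is
  injective, and an injective linear map in finite dimension is bounded below.\<close>

lemma linear_combination_coeffs_bound: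
  fixes A :: "'d::finite \<Rightarrow> 'v::euclidean_space"
  assumes "inj A" "independent (range A)"
  shows "\<exists>B>0. \<forall>lam :: real^'d. B * norm lam \<le> norm (\<Sum>l\<in>UNIV. lam $ l *\<^sub>R A l)"
proof -
  let ?f = "\<lambda>lam :: real^'d. \<Sum>l\<in>UNIV. lam $ l *\<^sub>R A l"
  have lin: "linear ?f"
    by (rule linearI) (simp_all add: algebra_simps sum.distrib scaleR_sum_right)
  have "lam = 0" if "?f lam = 0" for lam
  proof -
    have "(\<Sum>v\<in>range A. (lam $ inv A v) *\<^sub>R v) = 0"
      using that assms(1) by (simp add: sum.reindex)
    then have "lam $ inv A v = 0" if "v \<in> range A" for v
      using independentD[OF assms(2) finite_imageI[OF finite] order.refl,
          of "\<lambda>v. lam $ inv A v"] that by blast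
    then have "lam $ l = 0" for l
      using assms(1) by (metis inv_f_f rangeI)
    then show ?thesis by (simp add: vec_eq_iff)
  qed
  then have "inj ?f" using linear_injective_0[OF lin] by blast
  then show ?thesis
    using linear_inj_bounded_below_pos[OF lin] by metis
qed

text \<open>The directions in which all feasible \<open>Z\<close> are uniformly bounded form a subspace.\<close>

lemma bounded_dual_feasible:
  fixes A :: "'d::finite \<Rightarrow> real^'n3^'n2^'n1"
  assumes "inj A" "independent (range A)" "span X = UNIV"
  shows "bounded {p. dual_feasible A X p}"
proof -
  let ?F = "{Z. \<exists>lam. dual_feasible A X (lam, Z)}"
  let ?V = "{x. \<exists>B. \<forall>Z\<in>?F. onorm ((*v) (contract Z x)) \<le> B}"
  have "subspace ?V"
    unfolding subspace_def
  proof (intro conjI ballI allI)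
    show "0 \<in> ?V"
      by (auto simp: linear_0[OF linear_contract])
  next
    fix x y assume "x \<in> ?V" "y \<in> ?V"
    then obtain B B' where B: "\<forall>Z\<in>?F. onorm ((*v) (contract Z x)) \<le> B"
        "\<forall>Z\<in>?F. onorm ((*v) (contract Z y)) \<le> B'" by blast
    have "onorm ((*v) (contract Z (x + y))) \<le> B + B'" if "Z \<in> ?F" for Z
      using onorm_matrix_triangle[of "contract Z x" "contract Z y"] B that
      by (fastforce simp: linear_add[OF linear_contract])
    then show "x + y \<in> ?V" by blast
  next
    fix c x assume "x \<in> ?V"
    then obtain B where B: "\<forall>Z\<in>?F. onorm ((*v) (contract Z x)) \<le> B" by blast
    have "onorm ((*v) (contract Z (c *\<^sub>R x))) \<le> \<bar>c\<bar> * B" if "Z \<in> ?F" for Z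
      using B that by (simp add: linear_scale[OF linear_contract] onorm_matrix_scaleR mult_left_mono)
    then show "c *\<^sub>R x \<in> ?V" by blast
  qed
  moreover have "X \<subseteq> ?V"
  proof
    fix x assume "x \<in> X"
    then have "\<forall>Z\<in>?F. onorm ((*v) (contract Z x)) \<le> 1" by (auto simp: dual_feasible_iff)
    then show "x \<in> ?V" by blast
  qed
  \<comment> \<open>Slices are contractions with basis vectors, so this bounds every slice and then
    every entry of \<open>Z\<close>.\<close>
  ultimately have "?V = UNIV" using span_minimal[of X ?V] assms(3) by blast
  then have "axis j 1 \<in> ?V" for j by blast
  then have "\<forall>j. \<exists>B. \<forall>Z\<in>?F. onorm ((*v) (Z $ j)) \<le> B"
    by (simp add: contract_axis)
  then obtain B where B: "\<And>j Z. Z \<in> ?F \<Longrightarrow> onorm ((*v) (Z $ j)) \<le> B j" by metis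
  define C where "C = (\<Sum>j\<in>(UNIV::'n1 set). \<Sum>i\<in>(UNIV::'n2 set). \<Sum>k\<in>(UNIV::'n3 set). B j)"
  have Z_le: "norm Z \<le> C" if "Z \<in> ?F" for Z
  proof -
    have "norm (Z $ j $ i) \<le> (\<Sum>k\<in>(UNIV::'n3 set). B j)" for i j
    proof -
      have "norm (Z $ j $ i) \<le> (\<Sum>k\<in>UNIV. \<bar>Z $ j $ i $ k\<bar>)" by (rule norm_le_l1_cart)
      also have "\<dots> \<le> (\<Sum>k\<in>(UNIV::'n3 set). B j)"
        by (rule sum_mono) (rule order.trans[OF entry_le_onorm_matrix B[OF that]])
      finally show ?thesis .
    qed
    then have "norm (Z $ j) \<le> (\<Sum>i\<in>(UNIV::'n2 set). \<Sum>k\<in>(UNIV::'n3 set). B j)" for j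
      unfolding norm_vec_def[of "Z $ j"] by (intro order.trans[OF L2_set_le_sum] sum_mono) auto
    then show ?thesis
      unfolding C_def norm_vec_def[of Z] by (intro order.trans[OF L2_set_le_sum] sum_mono) auto
  qed
  \<comment> \<open>Independence carries the bound on \<open>Z\<close> over to its coefficients
    \<open>lam\<close>.\<close>
  obtain \<beta> where \<beta>: "\<beta> > 0" "\<And>lam :: real^'d. \<beta> * norm lam \<le> norm (\<Sum>l\<in>UNIV. lam $ l *\<^sub>R A l)"
    using linear_combination_coeffs_bound[OF assms(1,2)] by blast
  have "norm p \<le> C / \<beta> + C" if "dual_feasible A X p" for p
  proof -
    obtain lam Z where p: "p = (lam, Z)" by fastforce
    have "Z \<in> ?F" "Z = (\<Sum>l\<in>UNIV. lam $ l *\<^sub>R A l)"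
      using that p by (auto simp: dual_feasible_iff)
    then have "norm Z \<le> C" "\<beta> * norm lam \<le> C"
      using Z_le \<beta>(2)[of lam] by force+
    then have "norm Z \<le> C" "norm lam \<le> C / \<beta>"
      using \<beta>(1) by (simp_all add: pos_le_divide_eq mult.commute)
    then show ?thesis
      using norm_Pair_le[of lam Z] unfolding p by linarith
  qed
  then show ?thesis unfolding bounded_iff by blast
qed

section \<open>Properties of runs and of their limit points\<close>

lemma adaptive_run_reachedD:
  assumes "adaptive_run A b Ups lam Z xs" "reached Ups xs t"
  shows "dual_optimal A b (Ups t) (lam t, Z t)"
    and "norm x = 1 \<Longrightarrow> onorm ((*v) (contract (Z t) x)) \<le> onorm ((*v) (contract (Z t) (xs t)))"
    and "norm (xs t) = 1"
    and "xs t \<notin> Ups t \<Longrightarrow> Ups (Suc t) = insert (xs t) (Ups t)"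
  using assms unfolding adaptive_run_def is_arg_max_linorder spectral_norm_eq_onorm by blast+

lemma adaptive_run_samples:
  assumes "adaptive_run A b Ups lam Z xs" "reached Ups xs t"
  shows "finite (Ups t)" "Ups t \<subseteq> sphere 0 1"
proof -
  have "finite (Ups t) \<and> Ups t \<subseteq> sphere 0 1"
    using assms(2)
  proof (induction t)
    case 0
    \<comment> \<open>An infinite set has \<open>card\<close> zero, so a positive cardinality yields
      finiteness.\<close>
    have "card (Ups 0) \<noteq> 0" using assms(1) by (simp add: adaptive_run_def)
    then show ?case using assms(1) by (auto simp: adaptive_run_def intro: card_ge_0_finite)
  next
    case (Suc t)
    then have "reached Ups xs t" "xs t \<notin> Ups t" by (auto simp: reached_def)
    then show ?case
      using Suc.IH adaptive_run_reachedD(3,4)[OF assms(1), of t] by auto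
  qed
  then show "finite (Ups t)" "Ups t \<subseteq> sphere 0 1" by auto
qed

text \<open>The worst direction \<open>xs t\<close> is already constrained, so the relaxed optimum
  is feasible on the whole sphere and hence optimal there. Its value bounds the nuclear norm of the
  output from above and, by weak duality, that of every feasible tensor from below.\<close>

lemma adaptive_run_terminates:
  assumes run: "adaptive_run A b Ups lam Z xs" and terminates: "terminates_at Ups xs t"
  shows "dual_optimal A b (sphere 0 1) (lam t, Z t)"
    and "primal_optimal A b (Ups t) (That, Lam) \<Longrightarrow> tnn_optimal A b That"
proof -
  have t: "reached Ups xs t" "xs t \<in> Ups t" using terminates by (auto simp: terminates_at_def)
  note opt = adaptive_run_reachedD(1)[OF run t(1)]
  have "onorm ((*v) (contract (Z t) x)) \<le> 1" if "norm x = 1" for x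
    using adaptive_run_reachedD(2)[OF run t(1) that] opt t(2)
    by (fastforce simp: dual_optimal_iff dual_feasible_iff)
  then have feas: "dual_feasible A (sphere 0 1) (lam t, Z t)"
    using opt by (simp add: dual_optimal_iff dual_feasible_iff)
  then show "dual_optimal A b (sphere 0 1) (lam t, Z t)"
    using opt adaptive_run_samples(2)[OF run t(1)]
    unfolding dual_optimal_iff by (meson dual_feasible_antimono)
  assume P: "primal_optimal A b (Ups t) (That, Lam)"
  then have "tnn_feasible A b That"
    by (rule primal_optimal_tnn_feasible)
  moreover have "tensor_nuclear_norm That \<le> lam t \<bullet> b"
    using primal_optimal_nuclear_norm_le[OF adaptive_run_samples[OF run t(1)] opt P] .
  ultimately show "tnn_optimal A b That"
    unfolding tnn_optimal_def is_arg_min_linorder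
    using weak_duality[OF feas] by (meson order.trans)
qed

lemma dual_feasible_limit_point:
  fixes A :: "'d::finite \<Rightarrow> real^'n3^'n2^'n1"
  assumes run: "adaptive_run A b Ups lam Z xs" and reached: "\<And>t. reached Ups xs t"
    and mono: "\<And>s t. s < t \<Longrightarrow> xs s \<in> Ups t"
    and r: "strict_mono r" and lim: "(\<lambda>k. (lam (r k), Z (r k))) \<longlonglongrightarrow> (lam', Z')"
  shows "dual_feasible A (sphere 0 1) (lam', Z')"
proof -
  note opt = adaptive_run_reachedD(1)[OF run reached]
  have lim_lam: "(\<lambda>k. lam (r k)) \<longlonglongrightarrow> lam'" and lim_Z: "(\<lambda>k. Z (r k)) \<longlonglongrightarrow> Z'"
    using tendsto_fst[OF lim] tendsto_snd[OF lim] by simp_all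
  define C where "C = real CARD('n2) * real CARD('n1)"
  have C: "norm x = 1 \<Longrightarrow> onorm ((*v) (contract W x)) \<le> C * norm W"
    for x and W :: "real^'n3^'n2^'n1"
    unfolding C_def by (rule onorm_contract_le)
  \<comment> \<open>The error from replacing \<open>Z (r k)\<close> by \<open>Z'\<close>, uniform
    over unit vectors.\<close>
  define e where "e = (\<lambda>k. C * norm (Z (r k) - Z'))"
  have "e \<longlonglongrightarrow> C * norm (Z' - Z')"
    unfolding e_def by (intro tendsto_intros lim_Z)
  then have e: "e \<longlonglongrightarrow> 0" by simp
  have near: "onorm ((*v) (contract (Z (r k)) x)) \<le> onorm ((*v) (contract Z' x)) + e k"
    "onorm ((*v) (contract Z' x)) \<le> onorm ((*v) (contract (Z (r k)) x)) + e k"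
    if "norm x = 1" for k x
    using onorm_contract_le_near[of "Z (r k)" x Z'] onorm_contract_le_near[of Z' x "Z (r k)"]
      C[OF that, of "Z (r k) - Z'"] C[OF that, of "Z' - Z (r k)"]
    by (simp_all add: e_def norm_minus_commute)
  \<comment> \<open>For fixed \<open>k\<close>, all later iterates satisfy the constraint at
    \<open>xs (r k)\<close>; the limit \<open>j\<close> to infinity transfers it to
    \<open>Z'\<close>.\<close>
  have samples: "onorm ((*v) (contract Z' (xs (r k)))) \<le> 1" for k
  proof (rule tendsto_lowerbound[OF _ _ sequentially_bot])
    show "(\<lambda>j. 1 + e j) \<longlonglongrightarrow> 1" using tendsto_add[OF tendsto_const e, of 1] by simp
    show "\<forall>\<^sub>F j in sequentially. onorm ((*v) (contract Z' (xs (r k)))) \<le> 1 + e j"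
      using eventually_gt_at_top[of k]
    proof eventually_elim
      case (elim j)
      then have "onorm ((*v) (contract (Z (r j)) (xs (r k)))) \<le> 1"
        using opt[of "r j"] mono[OF strict_monoD[OF r elim]]
        by (auto simp: dual_optimal_iff dual_feasible_iff)
      then show ?case
        using near(2)[OF adaptive_run_reachedD(3)[OF run reached], of "r k" j] by simp
    qed
  qed
  have "onorm ((*v) (contract Z' x)) \<le> 1" if "norm x = 1" for x
  proof (rule tendsto_lowerbound[OF _ _ sequentially_bot])
    show "(\<lambda>k. 1 + e k + e k) \<longlonglongrightarrow> 1"
      using tendsto_add[OF tendsto_add[OF tendsto_const e] e, of 1] by simp
    show "\<forall>\<^sub>F k in sequentially. onorm ((*v) (contract Z' x)) \<le> 1 + e k + e k"
    proof (rule always_eventually, rule allI)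
      fix k
      show "onorm ((*v) (contract Z' x)) \<le> 1 + e k + e k"
        \<comment> \<open>One error is paid in passing from \<open>Z'\<close> to
          \<open>Z (r k)\<close> at \<open>x\<close>, the second in passing back to
          \<open>Z'\<close> at the maximizer \<open>xs (r k)\<close>.\<close>
        using near(2)[OF that, of k] adaptive_run_reachedD(2)[OF run reached that, of "r k"]
          near(1)[OF adaptive_run_reachedD(3)[OF run reached], of k "r k"] samples[of k]
        by linarith
    qed
  qed
  moreover have "Z' = (\<Sum>l\<in>UNIV. lam' $ l *\<^sub>R A l)"
  proof (rule LIMSEQ_unique[OF lim_Z])
    have "Z (r k) = (\<Sum>l\<in>UNIV. lam (r k) $ l *\<^sub>R A l)" for k
      using opt[of "r k"] by (simp add: dual_optimal_iff dual_feasible_iff)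
    then show "(\<lambda>k. Z (r k)) \<longlonglongrightarrow> (\<Sum>l\<in>UNIV. lam' $ l *\<^sub>R A l)"
      by (simp add: tendsto_intros lim_lam)
  qed
  ultimately show ?thesis by (simp add: dual_feasible_iff)
qed

text \<open>Each iterate solves a relaxation, so its value dominates that of every fully feasible
  point; this survives in the limit, which is itself feasible.\<close>

lemma adaptive_run_limit_point:
  assumes run: "adaptive_run A b Ups lam Z xs" and reached: "\<And>t. reached Ups xs t"
    and mono: "\<And>s t. s < t \<Longrightarrow> xs s \<in> Ups t"
    and r: "strict_mono r" and lim: "(\<lambda>k. (lam (r k), Z (r k))) \<longlonglongrightarrow> p"
  shows "dual_optimal A b (sphere 0 1) p"
proof -
  obtain lam' Z' where p: "p = (lam', Z')" by fastforce
  have lim_lam: "(\<lambda>k. lam (r k)) \<longlonglongrightarrow> lam'"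
    using tendsto_fst[OF lim] by (simp add: p)
  have "lam'' \<bullet> b \<le> lam' \<bullet> b" if "dual_feasible A (sphere 0 1) (lam'', Z'')" for lam'' Z''
  proof (rule tendsto_lowerbound[OF tendsto_inner[OF lim_lam tendsto_const] _ sequentially_bot])
    show "\<forall>\<^sub>F k in sequentially. lam'' \<bullet> b \<le> lam (r k) \<bullet> b"
      using adaptive_run_reachedD(1)[OF run reached]
        dual_feasible_antimono[OF that adaptive_run_samples(2)[OF run reached]]
      unfolding dual_optimal_iff by (intro always_eventually allI) blast
  qed
  then show ?thesis
    using dual_feasible_limit_point[OF run reached mono r lim[unfolded p]]
    by (auto simp: p dual_optimal_iff)
qed

lemma dual_val_eq:
  assumes "dual_optimal A b X (lam, Z)"
  shows "dual_val A b X = lam \<bullet> b"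
  unfolding dual_val_def
  by (rule cSup_eq_maximum) (use assms in \<open>force simp: dual_optimal_iff\<close>)+

theorem theorem6:
  fixes A :: "'d::finite \<Rightarrow> real^'n3^'n2^'n1" and b :: "real^'d"
    and Ups :: "nat \<Rightarrow> (real^'n1) set" and lam :: "nat \<Rightarrow> real^'d"
    and Z :: "nat \<Rightarrow> real^'n3^'n2^'n1" and xs :: "nat \<Rightarrow> real^'n1"
  assumes "inj A" and "independent (range A)"
    and "\<exists>T. tnn_feasible A b T"
    and "adaptive_run A b Ups lam Z xs"
  shows
    "(\<forall>tstar. terminates_at Ups xs tstar \<longrightarrow>
        dual_optimal A b (sphere 0 1) (lam tstar, Z tstar) \<and>
        (\<forall>That Lam. primal_optimal A b (Ups tstar) (That, Lam) \<longrightarrow> tnn_optimal A b That)) \<and>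
     ((\<nexists>tstar. terminates_at Ups xs tstar) \<longrightarrow>
        (\<forall>p r. strict_mono r \<and> (\<lambda>k. (lam (r k), Z (r k))) \<longlonglongrightarrow> p \<longrightarrow>
           dual_optimal A b (sphere 0 1) p) \<and>
        (\<lambda>t. lam t \<bullet> b) \<longlonglongrightarrow> dual_val A b (sphere 0 1) \<and>
        (\<forall>T Lam. (\<forall>t. primal_optimal A b (Ups t) (T t, Lam t)) \<longrightarrow>
           (\<lambda>t. tensor_nuclear_norm (T t)) \<longlonglongrightarrow> tnn_val A b))"
proof (intro conjI allI impI)
  fix t assume "terminates_at Ups xs t"
  note * = adaptive_run_terminates[OF assms(4) this]
  show "dual_optimal A b (sphere 0 1) (lam t, Z t)" by (rule *(1))
  show "tnn_optimal A b That" if "primal_optimal A b (Ups t) (That, Lam)" for That Lam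
    using that by (rule *(2))
next
  note run = assms(4)
  assume no_term: "\<nexists>t. terminates_at Ups xs t"
  have reached: "reached Ups xs t" for t
  proof (induction t)
    case (Suc t)
    then show ?case using no_term by (auto simp: terminates_at_def reached_def less_Suc_eq)
  qed (simp add: reached_def)
  have step: "Ups (Suc t) = insert (xs t) (Ups t)" for t
    using adaptive_run_reachedD(4)[OF run reached] no_term reached by (auto simp: terminates_at_def)
  have Ups_mono: "Ups s \<subseteq> Ups t" if "s \<le> t" for s t
    by (rule lift_Suc_mono_le[OF _ that]) (auto simp: step)
  have sample: "xs s \<in> Ups t" if "s < t" for s t
    using Ups_mono[of "Suc s" t] step[of s] that by auto
  note opt = adaptive_run_reachedD(1)[OF run reached]
  have limit_point: "dual_optimal A b (sphere 0 1) p"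
    if "strict_mono r" "(\<lambda>k. (lam (r k), Z (r k))) \<longlonglongrightarrow> p" for p r
    by (rule adaptive_run_limit_point[OF run reached sample that])
  show "dual_optimal A b (sphere 0 1) p"
    if "strict_mono r \<and> (\<lambda>k. (lam (r k), Z (r k))) \<longlonglongrightarrow> p" for p r
    using limit_point that by blast
  \<comment> \<open>Every \<open>Ups t\<close> contains the spanning set \<open>Ups 0\<close>, so
    all iterates lie in the bounded feasible set of the first problem.\<close>
  have "bounded (range (\<lambda>t. (lam t, Z t)))"
  proof (rule bounded_subset[OF bounded_dual_feasible[OF assms(1,2)]])
    show "span (Ups 0) = UNIV" using run by (simp add: adaptive_run_def)
    show "range (\<lambda>t. (lam t, Z t)) \<subseteq> {p. dual_feasible A (Ups 0) p}"
      using opt dual_feasible_antimono[OF _ Ups_mono[of 0]] unfolding dual_optimal_iff by blast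
  qed
  then obtain p r where r: "strict_mono r" and lim: "((\<lambda>t. (lam t, Z t)) \<circ> r) \<longlonglongrightarrow> p"
    using bounded_imp_convergent_subsequence by blast
  obtain lam' Z' where p: "p = (lam', Z')" by fastforce
  have opt': "dual_optimal A b (sphere 0 1) (lam', Z')"
    using limit_point[OF r] lim by (simp add: o_def p)
  have "(\<lambda>k. lam (r k)) \<longlonglongrightarrow> lam'"
    using tendsto_fst[OF lim] by (simp add: p o_def)
  then have sub: "((\<lambda>t. lam t \<bullet> b) \<circ> r) \<longlonglongrightarrow> lam' \<bullet> b"
    unfolding o_def by (intro tendsto_intros)
  have "lam t \<bullet> b \<le> lam s \<bullet> b" if "s \<le> t" for s t
    using dual_feasible_antimono[OF _ Ups_mono[OF that], of A "(lam t, Z t)"] opt[of s] opt[of t]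
    unfolding dual_optimal_iff by blast
  then have "decseq (\<lambda>t. lam t \<bullet> b)"
    by (simp add: decseq_def)
  moreover have "\<forall>t. 0 \<le> lam t \<bullet> b" using dual_optimal_nonneg[OF opt] by blast
  ultimately obtain L where L: "(\<lambda>t. lam t \<bullet> b) \<longlonglongrightarrow> L"
    using decseq_convergent by metis
  \<comment> \<open>Monotonicity gives convergence of the full sequence; the subsequence identifies
    the limit.\<close>
  then have "L = lam' \<bullet> b"
    using LIMSEQ_subseq_LIMSEQ[OF L r] sub LIMSEQ_unique by blast
  with L show conv: "(\<lambda>t. lam t \<bullet> b) \<longlonglongrightarrow> dual_val A b (sphere 0 1)"
    by (simp add: dual_val_eq[OF opt'])
  fix T Lam assume P: "\<forall>t. primal_optimal A b (Ups t) (T t, Lam t)"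
  have feas: "tnn_feasible A b (T t)" for t
    using P primal_optimal_tnn_feasible by blast
  have lower: "tnn_val A b \<le> tensor_nuclear_norm (T t)" for t
    unfolding tnn_val_def
    using feas by (intro cInf_lower bdd_belowI[of _ 0]) (auto simp: tensor_nuclear_norm_nonneg)
  have upper: "tensor_nuclear_norm (T t) \<le> lam t \<bullet> b" for t
    using primal_optimal_nuclear_norm_le[OF adaptive_run_samples[OF run reached] opt] P by blast
  \<comment> \<open>Absence of a duality gap: this inequality is weak duality, the reverse one is
    the limit of \<open>tnn_val A b \<le> lam t \<bullet> b\<close>.\<close>
  have "dual_val A b (sphere 0 1) \<le> tnn_val A b"
    unfolding dual_val_eq[OF opt'] tnn_val_def
    using assms(3) opt' weak_duality by (intro cInf_greatest) (auto simp: dual_optimal_iff)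
  moreover have "tnn_val A b \<le> dual_val A b (sphere 0 1)"
    by (rule LIMSEQ_le_const[OF conv]) (use order.trans[OF lower upper] in blast)
  ultimately have "dual_val A b (sphere 0 1) = tnn_val A b" by simp
  with conv have "(\<lambda>t. lam t \<bullet> b) \<longlonglongrightarrow> tnn_val A b" by simp
  then show "(\<lambda>t. tensor_nuclear_norm (T t)) \<longlonglongrightarrow> tnn_val A b"
    by (rule tendsto_sandwich[OF always_eventually always_eventually tendsto_const, rotated 2])
      (simp_all add: lower upper)
qed

end
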